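(* For all integers $n,k$ with $1\le k\le n$, \[ r(n,k)=s(n,k)+s(n,k-1), \] where $r(n,k)=\frac{1}{n-k+1}\binom{2n-k}{k}\binom{2n-2k}{n-k}$ and $s(n,k)=\frac{1}{n+1}\binom{n-1}{k}\binom{2n-k}{n}$ (with $\binom{a}{b}=0$ for $b>a\ge 0$).
   Context: Combinatorially, $r(n,k)$ is the number of $2\times n$ arrays of positive integers with strictly increasing rows, weakly increasing columns, and set of entries exactly $\{1,\ldots,2n-k\}$; $s(n,k)$ is the number of such arrays whose columns are also strictly increasing. *)

theory Defs
  imports Complex_Main
begin

(* Natural-number subtraction is exact in r_num for k <= n, and in s_num for n >= 1 and k <= n.
   The coefficient a choose b is 0 for b > a. The values are rational
   a priori: that the fractions are integers is not built into the definitions. *)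

definition r_num :: "nat \<Rightarrow> nat \<Rightarrow> rat" where
  "r_num n k = 1 / of_nat (n - k + 1)
     * of_nat ((2 * n - k) choose k) * of_nat ((2 * n - 2 * k) choose (n - k))"

definition s_num :: "nat \<Rightarrow> nat \<Rightarrow> rat" where
  "s_num n k = 1 / of_nat (n + 1)
     * of_nat ((n - 1) choose k) * of_nat ((2 * n - k) choose n)"

end

theory Submission
  imports Defs
begin

text \<open>Write \<open>n = m + k\<close>. In factorial form, \<open>s n k\<close> and \<open>s n (k - 1)\<close> are \<open>r n k\<close> times
  \<open>m (m + 1) / (n (n + 1))\<close> and \<open>k (2 m + k + 1) / (n (n + 1))\<close>, and the numerators of these two
  ratios add up to \<open>n (n + 1)\<close>.\<close>

text \<open>The factor \<open>fact (2 * m)\<close> cancels between the two binomials, and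
  \<open>1 / (m + 1)\<close> turns one \<open>fact m\<close> into
  \<open>fact (Suc m)\<close>.\<close>

lemma r_num_fact:
  "r_num (m + k) k = fact (2 * m + k) / (fact k * fact m * fact (Suc m))"
proof -
  have c1: "of_nat (2 * m + k choose k) = (fact (2 * m + k) / (fact k * fact (2 * m)) :: rat)"
    by (simp add: binomial_fact)
  have c2: "of_nat (2 * m choose m) = (fact (2 * m) / (fact m * fact m) :: rat)"
    by (simp add: binomial_fact)
  have d: "2 * (m + k) - k = 2 * m + k" "2 * (m + k) - 2 * k = 2 * m" "m + k - k = m"
    by simp_all
  show ?thesis
    unfolding r_num_def d c1 c2 fact_Suc by simp
qed

text \<open>Keeping \<open>of_nat m\<close> in the numerator covers \<open>m = 0\<close> as well.
  The assumption excludes \<open>m = k = 0\<close>, where truncated subtraction makes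
  \<open>s_num 0 0\<close> equal to 1 while the right side is 0.\<close>

lemma s_num_fact:
  assumes "0 < m + k"
  shows "s_num (m + k) k = of_nat m * fact (2 * m + k)
           / (fact k * fact m * fact m * of_nat (m + k) * of_nat (m + k + 1))"
proof (cases m)
  case 0
  \<comment> \<open>Here \<open>k - 1 choose k\<close> vanishes because
    \<open>k > 0\<close>.\<close>
  with assms show ?thesis
    by (simp add: s_num_def binomial_eq_0)
next
  case (Suc l)
  have c1: "of_nat (l + k choose k) = (fact (l + k) / (fact k * fact l) :: rat)"
    by (simp add: binomial_fact)
  have c2: "of_nat (2 * m + k choose (m + k)) =
    (fact (2 * m + k) / (fact (m + k) * fact m) :: rat)"
    by (simp add: binomial_fact)
  \<comment> \<open>Splitting off the top factors lets \<open>fact (l + k)\<close> cancel between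
    the binomials.\<close>
  have f: "fact (m + k) = (of_nat (m + k) * fact (l + k) :: rat)"
    "fact m = (of_nat m * fact l :: rat)"
    by (simp_all add: Suc)
  have d: "2 * (m + k) - k = 2 * m + k" "m + k - 1 = l + k"
    by (simp_all add: Suc)
  have "of_nat m \<noteq> (0 :: rat)"
    by (simp add: Suc del: of_nat_Suc)
  then show ?thesis
    unfolding s_num_def d c1 c2 f by (simp del: of_nat_add)
qed

theorem theorem2p1:
  fixes n k :: nat
  assumes "1 \<le> k" and "k \<le> n"
  shows "r_num n k = s_num n k + s_num n (k - 1)"
proof -
  obtain j where k: "k = Suc j"
    using assms(1) by (cases k) auto
  obtain m where n: "n = m + k"
    using assms(2) by (metis le_add_diff_inverse2)
  define F :: rat where "F = fact (2 * m + k) / (fact k * fact m * fact (Suc m))"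
  define N :: rat where "N = of_nat n * of_nat (n + 1)"
  have "N \<noteq> 0"
    unfolding N_def by (simp add: n k del: of_nat_Suc of_nat_add)
  have f: "fact (Suc m) = (of_nat (Suc m) * fact m :: rat)"
    by simp
  have "of_nat (Suc m) \<noteq> (0 :: rat)"
    by (simp del: of_nat_Suc)
  \<comment> \<open>The factor \<open>Suc m\<close> reduces \<open>fact (Suc m)\<close> in
    \<open>F\<close> to \<open>fact m\<close>.\<close>
  have "s_num n k = F * (of_nat m * of_nat (Suc m)) / N"
  proof -
    have "0 < m + k"
      by (simp add: k)
    with \<open>of_nat (Suc m) \<noteq> 0\<close> show ?thesis
      unfolding n F_def N_def f by (simp add: s_num_fact mult_ac del: of_nat_Suc of_nat_add)
  qed
  moreover have "s_num n (k - 1) = F * (of_nat k * of_nat (2 * m + k + 1)) / N"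
  proof -
    \<comment> \<open>With \<open>n\<close> fixed, passing from \<open>k\<close> to
      \<open>j = k - 1\<close> replaces \<open>m\<close> by \<open>Suc m\<close>, so
      \<open>2 * m + k\<close> grows by one.\<close>
    have g: "fact (2 * Suc m + j) = (of_nat (2 * m + k + 1) * fact (2 * m + k) :: rat)"
      "fact k = (of_nat k * fact j :: rat)"
      by (simp_all add: k)
    have "of_nat k \<noteq> (0 :: rat)"
      by (simp add: k del: of_nat_Suc)
    moreover have "n = Suc m + j" "k - 1 = j"
      by (simp_all add: n k)
    moreover have "s_num (Suc m + j) j = of_nat (Suc m) * fact (2 * Suc m + j)
        / (fact j * fact (Suc m) * fact (Suc m) * of_nat (Suc m + j) * of_nat (Suc m + j + 1))"
      by (rule s_num_fact) simp
    ultimately show ?thesis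
      using \<open>of_nat (Suc m) \<noteq> 0\<close> unfolding F_def N_def g f
      by (simp add: mult_ac del: of_nat_Suc of_nat_add add_Suc)
  qed
  \<comment> \<open>Both sides expand to \<open>(m + k)^2 + (m + k)\<close>.\<close>
  moreover have "of_nat m * of_nat (Suc m) + of_nat k * of_nat (2 * m + k + 1) = N"
    by (simp add: N_def n algebra_simps)
  ultimately have "s_num n k + s_num n (k - 1) = F * N / N"
    by (metis add_divide_distrib distrib_left)
  with \<open>N \<noteq> 0\<close> show ?thesis
    by (simp add: n r_num_fact F_def)
qed

end
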